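(* Let $(X,d)$ be a metric space with at least two points and let $\mathcal{B}$ be a bornology on $X$ with a closed base. Then \begin{align*} w(C(X),\tau_{\mathcal{B}}^{w})&=w_X(\mathcal{B})\cdot ib(C(X),\tau_{\mathcal{B}}^{w})=w_X(\mathcal{B})\cdot c(C(X),\tau_{\mathcal{B}}^{w})=w_X(\mathcal{B})\cdot L(C(X),\tau_{\mathcal{B}}^{w})\\ &=w_X(\mathcal{B})\cdot d(C(X),\tau_{\mathcal{B}}^{w})=w_X(\mathcal{B})\cdot nw(C(X),\tau_{\mathcal{B}}^{w}). \end{align*}
   Context: A bornology on $X$ is a family $\mathcal{B}$ of nonempty subsets of $X$ that covers $X$ and is an ideal, i.e. is closed under finite unions and under passing to nonempty subsets. A base for $\mathcal{B}$ is a subfamily $\mathcal{B}_0\subseteq\mathcal{B}$ such that every $B\in\mathcal{B}$ is contained in some $B'\in\mathcal{B}_0$; $\mathcal{B}$ has a closed base if it has a base all of whose members are closed in $(X,d)$. The weight of $\mathcal{B}$ is $w_X(\mathcal{B})=\aleph_0+\min\{|\mathcal{B}_0| : \mathcal{B}_0 \text{ is a base for } \mathcal{B}\}$. $C(X)$ is the set of continuous functions $X\to\mathbb{R}$, and $C^+(X)$ the set of continuous functions $X\to(0,\infty)$. The topology $\tau_{\mathcal{B}}^{w}$ of Whitney convergence on $\mathcal{B}$ is the topology on $C(X)$ induced by the uniformity having as a base the sets $[B,\epsilon]^{w}=\{(f,g): |f(x)-g(x)|<\epsilon(x)\ \forall x\in B\}$ with $B\in\mathcal{B}$, $\epsilon\in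 C^+(X)$. $C(X)$ with this topology is a topological group under pointwise addition. For a topological space $Y$: weight $w(Y)=\aleph_0+\min\{|\mathscr{B}|:\mathscr{B}\text{ is a base for }Y\}$; density $d(Y)=\aleph_0+\min\{|D|:D\text{ dense in }Y\}$; cellularity $c(Y)=\aleph_0+\sup\{|\mathscr{U}|:\mathscr{U}\text{ is a pairwise disjoint family of open subsets of }Y\}$; Lindelöf degree $L(Y)=\aleph_0+\min\{\mathfrak{m}:\text{every open cover of }Y\text{ has a subcover of cardinality}\le\mathfrak{m}\}$; a network on $Y$ is a collection $\mathscr{N}$ of nonempty subsets such that for each $y\in Y$ and open $U\ni y$ there is $C\in\mathscr{N}$ with $y\in C\subseteq U$; network weight $nw(Y)=\aleph_0+\min\{|\mathscr{N}|:\mathscr{N}\text{ is a network on }Y\}$. For an additive topological group $Y$ and an infinite cardinal $\lambda$, $Y$ is $\lambda$-narrow if for every neighborhood $U$ of the identity there is $S\subseteq Y$ with $|S|\le\lambda$ and $Y=U+S$; the index of narrowness is $ib(Y)=\aleph_0+\min\{\lambda: Y\text{ is }\lambda\text{-narrow}\}$. *)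

theory Defs
  imports "HOL-Analysis.Analysis" "HOL-Library.Function_Algebras"
begin

unbundle cardinal_syntax

section \<open>Minima and suprema of cardinals\<close>

text \<open>
  Cardinals are the cardinal orders of HOL (\<open>|A|\<close>, compared by \<open>\<le>o\<close> and \<open>=o\<close>, added and multiplied
  by \<open>+c\<close> and \<open>*c\<close>, with \<open>natLeq\<close> as aleph-zero).  A family of cardinals is represented by a family
  of sets having these cardinalities.  \<open>min_card F\<close> is meaningful only for nonempty \<open>F\<close>.
\<close>

definition min_card :: "'c set set \<Rightarrow> 'c rel" where
  "min_card F = |SOME A. A \<in> F \<and> (\<forall>B\<in>F. |A| \<le>o |B| )|"

definition sup_card :: "'c set set \<Rightarrow> 'c rel" where
  "sup_card F = min_card {A. \<forall>B\<in>F. |B| \<le>o |A|}"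

lemma min_card_attained:
  assumes "F \<noteq> {}"
  shows "(\<exists>A\<in>F. min_card F = |A| ) \<and> (\<forall>B\<in>F. min_card F \<le>o |B| )"
proof -
  have "\<exists>r\<in>card_of ` F. \<forall>r'\<in>card_of ` F. r \<le>o r'"
    using assms by (intro exists_minim_Card_order) (auto intro: card_of_Card_order)
  then have "\<exists>A. A \<in> F \<and> (\<forall>B\<in>F. |A| \<le>o |B| )"
    by auto
  from someI_ex[OF this] show ?thesis
    unfolding min_card_def by (rule conj_forward) (rule bexI, rule refl)
qed

lemma sup_card_upper:
  fixes F :: "'c set set"
  assumes "B \<in> F"
  shows "|B| \<le>o sup_card F"
proof -
  have "UNIV \<in> {A :: 'c set. \<forall>B\<in>F. |B| \<le>o |A|}"
    by (simp add: card_of_mono1)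
  then have "{A :: 'c set. \<forall>B\<in>F. |B| \<le>o |A|} \<noteq> {}"
    by blast
  from conjunct1[OF min_card_attained[OF this]] obtain A where
    "\<forall>B\<in>F. |B| \<le>o |A|" "sup_card F = |A|"
    unfolding sup_card_def by auto
  with assms show ?thesis
    by simp
qed

text \<open>The bound may live on an arbitrary type, so \<open>sup_card\<close> is the supremum among all cardinals.\<close>

lemma sup_card_least:
  fixes F :: "'c set set" and r :: "'d rel"
  assumes "Card_order r" and bound: "\<And>B. B \<in> F \<Longrightarrow> |B| \<le>o r"
  shows "sup_card F \<le>o r"
proof -
  let ?U = "{A :: 'c set. \<forall>B\<in>F. |B| \<le>o |A|}"
  have U: "UNIV \<in> ?U"
    by (simp add: card_of_mono1)
  then have ne: "?U \<noteq> {}"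
    by blast
  have r: "r =o |Field r|"
    using assms(1) by (simp add: card_of_Field_ordIso ordIso_symmetric)
  have min: "sup_card F \<le>o |A|" if "A \<in> ?U" for A
    using bspec[OF conjunct2[OF min_card_attained[OF ne]] that] unfolding sup_card_def .
  consider "|Field r| \<le>o |UNIV :: 'c set|" | "|UNIV :: 'c set| \<le>o |Field r|"
    using ordLeq_total[OF card_of_Well_order card_of_Well_order] by metis
  then show ?thesis
  proof cases
    case 1
    then obtain A :: "'c set" where A: "|Field r| =o |A|"
      using iffD1[OF internalize_card_of_ordLeq2 1] by auto
    have rA: "r =o |A|"
      by (rule ordIso_transitive[OF r A])
    have "A \<in> ?U"
      by (auto intro: ordLeq_ordIso_trans[OF bound rA])
    then show ?thesis
      by (rule ordLeq_ordIso_trans[OF min ordIso_symmetric[OF rA]])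
  next
    case 2
    show ?thesis
      by (rule ordLeq_ordIso_trans[OF ordLeq_transitive[OF min[OF U] 2] ordIso_symmetric[OF r]])
  qed
qed

section \<open>Cardinal functions of a topological space\<close>

definition topology_base :: "'b topology \<Rightarrow> 'b set set \<Rightarrow> bool" where
  "topology_base Y \<B> \<longleftrightarrow> (\<forall>V\<in>\<B>. openin Y V) \<and>
     (\<forall>U y. openin Y U \<and> y \<in> U \<longrightarrow> (\<exists>V\<in>\<B>. y \<in> V \<and> V \<subseteq> U))"

definition network :: "'b topology \<Rightarrow> 'b set set \<Rightarrow> bool" where
  "network Y \<N> \<longleftrightarrow> (\<forall>C\<in>\<N>. C \<noteq> {} \<and> C \<subseteq> topspace Y) \<and>
     (\<forall>U y. openin Y U \<and> y \<in> U \<longrightarrow> (\<exists>C\<in>\<N>. y \<in> C \<and> C \<subseteq> U))"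

definition weight :: "'b topology \<Rightarrow> (nat + 'b set) rel" where
  "weight Y = natLeq +c min_card {\<B>. topology_base Y \<B>}"

definition network_weight :: "'b topology \<Rightarrow> (nat + 'b set) rel" where
  "network_weight Y = natLeq +c min_card {\<N>. network Y \<N>}"

definition topological_density :: "'b topology \<Rightarrow> (nat + 'b) rel" where
  "topological_density Y = natLeq +c min_card {D. D \<subseteq> topspace Y \<and> Y closure_of D = topspace Y}"

definition cellularity :: "'b topology \<Rightarrow> (nat + 'b set) rel" where
  "cellularity Y = natLeq +c sup_card {\<U>. (\<forall>U\<in>\<U>. openin Y U) \<and> pairwise disjnt \<U>}"

text \<open>
  Every open cover is its own subcover, so the minimal cardinal below is at most the number of open
  sets and is therefore the cardinality of some \<open>M :: 'b set set\<close>.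
\<close>

definition lindelof_degree :: "'b topology \<Rightarrow> (nat + 'b set) rel" where
  "lindelof_degree Y = natLeq +c min_card {M :: 'b set set.
     \<forall>\<U>. (\<forall>U\<in>\<U>. openin Y U) \<and> \<Union>\<U> = topspace Y \<longrightarrow>
       (\<exists>\<V>. \<V> \<subseteq> \<U> \<and> \<Union>\<V> = topspace Y \<and> |\<V>| \<le>o |M| )}"

section \<open>Index of narrowness\<close>

text \<open>
  The group is the subset \<open>topspace Y\<close> of the ambient type, with the addition of that type.
\<close>

definition narrow :: "'k rel \<Rightarrow> 'b::group_add topology \<Rightarrow> bool" where
  "narrow r Y \<longleftrightarrow>
     (\<forall>U. U \<subseteq> topspace Y \<and> (\<exists>V. openin Y V \<and> 0 \<in> V \<and> V \<subseteq> U) \<longrightarrow>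
       (\<exists>S. S \<subseteq> topspace Y \<and> |S| \<le>o r \<and> topspace Y = {u + s | u s. u \<in> U \<and> s \<in> S}))"

text \<open>
  The infinite cardinals are represented by infinite subsets of \<open>nat + 'b\<close>; this loses nothing, since
  \<open>Y\<close> is narrow for the cardinality of that type.
\<close>

definition narrowness_index :: "'b::group_add topology \<Rightarrow> (nat + (nat + 'b)) rel" where
  "narrowness_index Y = natLeq +c min_card {L :: (nat + 'b) set. infinite L \<and> narrow |L| Y}"

section \<open>Bornologies\<close>

definition bornology :: "'a set set \<Rightarrow> bool" where
  "bornology \<B> \<longleftrightarrow> {} \<notin> \<B> \<and> \<Union>\<B> = UNIV \<and>
     (\<forall>A\<in>\<B>. \<forall>B\<in>\<B>. A \<union> B \<in> \<B>) \<and>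
     (\<forall>B\<in>\<B>. \<forall>A. A \<noteq> {} \<and> A \<subseteq> B \<longrightarrow> A \<in> \<B>)"

definition bornology_base :: "'a set set \<Rightarrow> 'a set set \<Rightarrow> bool" where
  "bornology_base \<B> \<B>0 \<longleftrightarrow> \<B>0 \<subseteq> \<B> \<and> (\<forall>B\<in>\<B>. \<exists>B'\<in>\<B>0. B \<subseteq> B')"

definition has_closed_base :: "'a::topological_space set set \<Rightarrow> bool" where
  "has_closed_base \<B> \<longleftrightarrow> (\<exists>\<B>0. bornology_base \<B> \<B>0 \<and> (\<forall>B\<in>\<B>0. closed B))"

definition bornology_weight :: "'a set set \<Rightarrow> (nat + 'a set) rel" where
  "bornology_weight \<B> = natLeq +c min_card {\<B>0. bornology_base \<B> \<B>0}"

section \<open>Whitney convergence on a bornology\<close>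

definition cont_funs :: "('a::topological_space \<Rightarrow> real) set" where
  "cont_funs = {f. continuous_on UNIV f}"

definition pos_cont_funs :: "('a::topological_space \<Rightarrow> real) set" where
  "pos_cont_funs = {\<epsilon>. continuous_on UNIV \<epsilon> \<and> (\<forall>x. 0 < \<epsilon> x)}"

definition whitney_entourage ::
    "'a::topological_space set \<Rightarrow> ('a \<Rightarrow> real) \<Rightarrow> (('a \<Rightarrow> real) \<times> ('a \<Rightarrow> real)) set" where
  "whitney_entourage B \<epsilon> =
     {(f, g). f \<in> cont_funs \<and> g \<in> cont_funs \<and> (\<forall>x\<in>B. \<bar>f x - g x\<bar> < \<epsilon> x)}"

text \<open>
  The topology induced by the uniformity with base \<open>whitney_entourage B \<epsilon>\<close>: a set is open iff with
  each of its points \<open>f\<close> it contains the section at \<open>f\<close> of some basic entourage.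
\<close>

definition whitney_topology :: "'a::topological_space set set \<Rightarrow> ('a \<Rightarrow> real) topology" where
  "whitney_topology \<B> = topology (\<lambda>U. U \<subseteq> cont_funs \<and>
     (\<forall>f\<in>U. \<exists>B\<in>\<B>. \<exists>\<epsilon>\<in>pos_cont_funs. whitney_entourage B \<epsilon> `` {f} \<subseteq> U))"

lemma openin_whitney_topology:
  assumes "bornology \<B>"
  shows "openin (whitney_topology \<B>) U \<longleftrightarrow> U \<subseteq> cont_funs \<and>
     (\<forall>f\<in>U. \<exists>B\<in>\<B>. \<exists>\<epsilon>\<in>pos_cont_funs. whitney_entourage B \<epsilon> `` {f} \<subseteq> U)"
proof -
  define P where "P U \<longleftrightarrow> U \<subseteq> cont_funs \<and>
     (\<forall>f\<in>U. \<exists>B\<in>\<B>. \<exists>\<epsilon>\<in>pos_cont_funs. whitney_entourage B \<epsilon> `` {f} \<subseteq> U)" for U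
  have inter: "P (S \<inter> T)" if S: "P S" and T: "P T" for S T
    unfolding P_def
  proof (intro conjI ballI)
    show "S \<inter> T \<subseteq> cont_funs"
      using S unfolding P_def by blast
    fix f assume "f \<in> S \<inter> T"
    with S T obtain A \<delta> B \<epsilon> where *: "A \<in> \<B>" "\<delta> \<in> pos_cont_funs" "B \<in> \<B>" "\<epsilon> \<in> pos_cont_funs"
        "whitney_entourage A \<delta> `` {f} \<subseteq> S" "whitney_entourage B \<epsilon> `` {f} \<subseteq> T"
      unfolding P_def by (metis IntD1 IntD2)
    have "A \<union> B \<in> \<B>"
      using assms * unfolding bornology_def by blast
    moreover have "(\<lambda>x. min (\<delta> x) (\<epsilon> x)) \<in> pos_cont_funs"
      using * by (auto simp: pos_cont_funs_def intro: continuous_on_min)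
    moreover have "whitney_entourage (A \<union> B) (\<lambda>x. min (\<delta> x) (\<epsilon> x)) `` {f} \<subseteq> S \<inter> T"
      using *(5,6) by (auto simp: whitney_entourage_def)
    ultimately show "\<exists>B\<in>\<B>. \<exists>\<epsilon>\<in>pos_cont_funs. whitney_entourage B \<epsilon> `` {f} \<subseteq> S \<inter> T"
      by blast
  qed
  have union: "P (\<Union>K)" if K: "\<forall>S\<in>K. P S" for K
    unfolding P_def
  proof (intro conjI ballI)
    show "\<Union>K \<subseteq> cont_funs"
      using K unfolding P_def by blast
    fix f assume "f \<in> \<Union>K"
    then obtain S where S: "S \<in> K" "f \<in> S"
      by blast
    with K obtain B \<epsilon> where "B \<in> \<B>" "\<epsilon> \<in> pos_cont_funs" "whitney_entourage B \<epsilon> `` {f} \<subseteq> S"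
      unfolding P_def by blast
    with S show "\<exists>B\<in>\<B>. \<exists>\<epsilon>\<in>pos_cont_funs. whitney_entourage B \<epsilon> `` {f} \<subseteq> \<Union>K"
      by (meson Union_upper order_trans)
  qed
  have "istopology P"
    unfolding istopology_def using inter union by simp
  then have "openin (topology P) = P"
    by (rule topology_inverse')
  moreover have "whitney_topology \<B> = topology P"
    unfolding whitney_topology_def P_def[abs_def] ..
  ultimately show ?thesis
    by (simp only: P_def)
qed

lemma topspace_whitney_topology:
  assumes "bornology \<B>"
  shows "topspace (whitney_topology \<B>) = cont_funs"
proof -
  have "undefined \<in> \<Union>\<B>"
    using assms unfolding bornology_def by simp
  then obtain B where B: "B \<in> \<B>"
    by (rule UnionE)
  have one: "(\<lambda>_. 1) \<in> pos_cont_funs"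
    by (simp add: pos_cont_funs_def)
  have "whitney_entourage B (\<lambda>_. 1) `` {f} \<subseteq> cont_funs" for f
    by (auto simp: whitney_entourage_def)
  then have "\<exists>B\<in>\<B>. \<exists>\<epsilon>\<in>pos_cont_funs. whitney_entourage B \<epsilon> `` {f} \<subseteq> cont_funs" for f
    using B one by blast
  then have "openin (whitney_topology \<B>) cont_funs"
    unfolding openin_whitney_topology[OF assms] by blast
  then have "cont_funs \<subseteq> topspace (whitney_topology \<B>)"
    by (rule openin_subset)
  moreover have "topspace (whitney_topology \<B>) \<subseteq> cont_funs"
    using openin_topspace[of "whitney_topology \<B>"]
    unfolding openin_whitney_topology[OF assms] by (rule conjunct1)
  ultimately show ?thesis
    by (rule subset_antisym[rotated])
qed

end

theory Submission
  imports Defs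
begin

text \<open>
  Write \<open>Y\<close> for the space of continuous functions, \<open>\<kappa>\<close> for the weight of the bornology and \<open>ib\<close>
  for the index of narrowness of \<open>Y\<close>. In an abelian topological group \<open>ib\<close> is at most the
  cellularity, the Lindeloef degree, the density and hence the network weight, and in any space
  all of these are at most the weight \<open>w(Y)\<close>. The whole chain of equalities therefore collapses
  once \<open>\<kappa> \<le> w(Y)\<close> and \<open>w(Y) \<le> \<kappa> \<cdot> ib\<close> are known (\<open>cprod_sandwich\<close>).

  The first inequality (\<open>bornology_weight_le_weight\<close>) comes from separation: if a ball around
  zero over a closed set \<open>D\<close> is contained in the unit ball over \<open>C\<close>, then \<open>C \<subseteq> D\<close>, because a
  continuous function vanishing on \<open>D\<close> can take the value 1 at any given point off \<open>D\<close>. So the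
  members of a base of \<open>Y\<close> that contain zero yield a base of the bornology.

  The second inequality rests on the bound of the weight of a group by the product of \<open>ib\<close> and
  the size of a local base at zero (\<open>weight_le_if_small_local_base\<close>). The radii \<open>\<epsilon>\<close> could force a
  local base much larger than \<open>\<kappa>\<close>, but narrowness controls them as well: a set \<open>S\<close> of at most
  \<open>ib\<close> translations that covers \<open>Y\<close> by translates of the unit ball over \<open>C\<close> has, for every \<open>\<epsilon>\<close>, a
  member \<open>s\<close> at distance less than 1 from \<open>1 / \<epsilon>\<close> on \<open>C\<close>, so that \<open>1 / (1 + \<bar>s\<bar>) < \<epsilon>\<close> there.
  Hence the radii \<open>1 / (1 + \<bar>s\<bar>)\<close> suffice over \<open>C\<close>, and \<open>\<kappa> \<cdot> ib\<close> balls form a local base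
  (\<open>weight_le_bornology_weight_narrowness_index\<close>).
\<close>

section \<open>Cardinals of the form aleph-zero plus a minimum\<close>

lemma Card_order_min_card: "Card_order (min_card F)"
  unfolding min_card_def by (rule card_of_Card_order)

lemma Cinfinite_natLeq_csum: "Cinfinite (natLeq +c r)"
  by (meson Card_order_csum cinfinite_csum natLeq_cinfinite)

text \<open>
  The cardinal functions that are minima have the form \<open>natLeq +c min_card F\<close>. This fact and
  \<open>aleph0_min_card_least\<close> reduce their comparison to exhibiting single members of \<open>F\<close>.
\<close>

lemma aleph0_min_card_attained:
  assumes "F \<noteq> {}"
  shows "\<exists>A\<in>F. |A| \<le>o natLeq +c min_card F"
proof -
  obtain A where A: "A \<in> F" "min_card F = |A|"
    using min_card_attained[OF assms] by blast
  have "|A| \<le>o natLeq +c |A|"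
    by (rule ordLeq_csum2[OF card_of_Card_order])
  with A show ?thesis by metis
qed

lemma aleph0_csum_least:
  assumes "Cinfinite r" "Card_order p" "p \<le>o r"
  shows "natLeq +c p \<le>o r"
  using assms by (meson csum_cinfinite_bound natLeq_Card_order natLeq_ordLeq_cinfinite)

lemma aleph0_min_card_least:
  assumes "Cinfinite r" "A \<in> F" "|A| \<le>o r"
  shows "natLeq +c min_card F \<le>o r"
proof -
  have "min_card F \<le>o |A|"
    using min_card_attained[of F] assms(2) by blast
  then show ?thesis
    by (intro aleph0_csum_least[OF assms(1) Card_order_min_card]) (rule ordLeq_transitive[OF _ assms(3)])
qed

text \<open>
  With \<open>w\<close> the weight of the space, \<open>k\<close> that of the bornology and \<open>i\<close> the index of narrowness,
  this gives each of the five products by taking the corresponding cardinal function for \<open>x\<close>: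
  \<open>w \<le> k \<cdot> i \<le> k \<cdot> x \<le> w \<cdot> w = w\<close>.
\<close>

lemma cprod_sandwich:
  fixes w :: "'w rel" and k :: "'k rel" and x :: "'x rel" and i :: "'i rel"
  assumes "Cinfinite w" "Card_order k" "Card_order x" "Card_order i"
    and "k \<le>o w" "x \<le>o w" "i \<le>o x" "w \<le>o k *c i"
  shows "w =o k *c x"
proof -
  have "k *c i \<le>o k *c x"
    by (rule cprod_mono2[OF \<open>i \<le>o x\<close>])
  moreover have "k *c x \<le>o w"
    using assms by (intro cprod_cinfinite_bound)
  ultimately show ?thesis
    using \<open>w \<le>o k *c i\<close> ordIso_iff_ordLeq ordLeq_transitive by blast
qed

section \<open>Cardinal functions bounded by the weight\<close>

lemma weight_attained:
  obtains \<C> where "topology_base Y \<C>" "|\<C>| \<le>o weight Y"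
proof -
  have "topology_base Y {U. openin Y U}"
    unfolding topology_base_def by blast
  then have "{\<C>. topology_base Y \<C>} \<noteq> {}" by blast
  from aleph0_min_card_attained[OF this, folded weight_def] that show thesis by blast
qed

text \<open>
  Disjoint nonempty open sets contain distinct members of a base.
\<close>

lemma cellularity_le_weight: "cellularity Y \<le>o weight Y"
proof -
  obtain \<C> where \<C>: "topology_base Y \<C>" "|\<C>| \<le>o weight Y"
    by (rule weight_attained)
  have inf: "Cinfinite (weight Y)"
    unfolding weight_def by (rule Cinfinite_natLeq_csum)
  have bound: "|\<U>| \<le>o weight Y" if \<U>: "\<forall>U\<in>\<U>. openin Y U" "pairwise disjnt \<U>" for \<U>
  proof -
    have "\<exists>V\<in>\<C>. V \<noteq> {} \<and> V \<subseteq> U" if "U \<in> \<U> - {{}}" for U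
      using that \<U>(1) \<C>(1) unfolding topology_base_def by blast
    then obtain f where f: "\<And>U. U \<in> \<U> - {{}} \<Longrightarrow> f U \<in> \<C> \<and> f U \<noteq> {} \<and> f U \<subseteq> U"
      by metis
    have "inj_on f (\<U> - {{}})"
    proof (rule inj_onI, rule ccontr)
      fix U U' assume U: "U \<in> \<U> - {{}}" "U' \<in> \<U> - {{}}" "f U = f U'" "U \<noteq> U'"
      then have "disjnt U U'" using \<U>(2) unfolding pairwise_def by blast
      with f[OF U(1)] f[OF U(2)] U(3) show False
        unfolding disjnt_def by blast
    qed
    moreover have "f ` (\<U> - {{}}) \<subseteq> \<C>" using f by blast
    ultimately have "|\<U> - {{}}| \<le>o |\<C>|"
      using card_of_ordLeq by blast
    then have "|\<U> - {{}}| \<le>o weight Y"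
      using \<C>(2) by (rule ordLeq_transitive)
    moreover have "|{{}} :: 'b set set| \<le>o weight Y"
      using inf card_of_Card_order
      by (intro ordLess_imp_ordLeq[OF Cfinite_ordLess_Cinfinite]) (simp_all add: cfinite_def Field_card_of)
    \<comment> \<open>A pairwise disjoint family may have the empty set as one further member.\<close>
    ultimately have "|{{}} \<union> (\<U> - {{}})| \<le>o weight Y"
      using inf by (intro card_of_Un_ordLeq_infinite_Field) (auto simp: cinfinite_def)
    then show ?thesis
      using card_of_mono1[of \<U> "{{}} \<union> (\<U> - {{}})"] ordLeq_transitive by blast
  qed
  have "sup_card {\<U>. (\<forall>U\<in>\<U>. openin Y U) \<and> pairwise disjnt \<U>} \<le>o weight Y"
    using inf bound by (intro sup_card_least) auto
  then show ?thesis
    unfolding cellularity_def sup_card_def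
    by (rule aleph0_csum_least[OF inf Card_order_min_card])
qed

text \<open>
  From a cover, one set is chosen around each member of a base that fits inside some set of the
  cover; every point lies in such a member.
\<close>

lemma lindelof_degree_le_weight: "lindelof_degree Y \<le>o weight Y"
proof -
  obtain \<C> where \<C>: "topology_base Y \<C>" "|\<C>| \<le>o weight Y"
    by (rule weight_attained)
  have "\<exists>\<V>\<subseteq>\<U>. \<Union>\<V> = topspace Y \<and> |\<V>| \<le>o |\<C>|"
    if \<U>: "\<forall>U\<in>\<U>. openin Y U" "\<Union>\<U> = topspace Y" for \<U>
  proof -
    define \<C>' where "\<C>' = {V \<in> \<C>. \<exists>U\<in>\<U>. V \<subseteq> U}"
    then have "\<forall>V\<in>\<C>'. \<exists>U. U \<in> \<U> \<and> V \<subseteq> U" by blast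
    then obtain f where f: "\<And>V. V \<in> \<C>' \<Longrightarrow> f V \<in> \<U> \<and> V \<subseteq> f V"
      unfolding bchoice_iff by blast
    have "topspace Y \<subseteq> \<Union>(f ` \<C>')"
    proof
      fix y assume "y \<in> topspace Y"
      then obtain U where U: "U \<in> \<U>" "y \<in> U" using \<U>(2) by blast
      then obtain V where "V \<in> \<C>" "y \<in> V" "V \<subseteq> U"
        using \<C>(1) \<U>(1) unfolding topology_base_def by blast
      with U show "y \<in> \<Union>(f ` \<C>')" using f[of V] unfolding \<C>'_def by blast
    qed
    moreover have sub: "f ` \<C>' \<subseteq> \<U>" using f by blast
    ultimately have "\<Union>(f ` \<C>') = topspace Y" using \<U>(2) by blast
    moreover have "|f ` \<C>'| \<le>o |\<C>|"
      by (rule ordLeq_transitive[OF card_of_image card_of_mono1]) (simp add: \<C>'_def)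
    ultimately show ?thesis using sub by blast
  qed
  then show ?thesis
    unfolding lindelof_degree_def
    by (intro aleph0_min_card_least[OF _ _ \<C>(2)])
       (auto simp: weight_def Cinfinite_natLeq_csum)
qed

lemma network_weight_le_weight: "network_weight Y \<le>o weight Y"
proof -
  obtain \<C> where \<C>: "topology_base Y \<C>" "|\<C>| \<le>o weight Y"
    by (rule weight_attained)
  have "network Y (\<C> - {{}})"
    unfolding network_def
  proof (intro conjI ballI allI impI)
    fix C assume "C \<in> \<C> - {{}}"
    then show "C \<noteq> {}" "C \<subseteq> topspace Y"
      using \<C>(1) openin_subset[of Y C] unfolding topology_base_def by blast+
  next
    fix U y assume "openin Y U \<and> y \<in> U"
    then show "\<exists>C\<in>\<C> - {{}}. y \<in> C \<and> C \<subseteq> U"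
      using \<C>(1) unfolding topology_base_def by blast
  qed
  moreover have "|\<C> - {{}}| \<le>o weight Y"
    by (rule ordLeq_transitive[OF card_of_mono1 \<C>(2)]) blast
  ultimately show ?thesis
    unfolding network_weight_def
    by (intro aleph0_min_card_least) (auto simp: weight_def Cinfinite_natLeq_csum)
qed

text \<open>
  One point chosen from each member of a network gives a dense set.
\<close>

lemma topological_density_le_network_weight: "topological_density Y \<le>o network_weight Y"
proof -
  have "network Y {U. openin Y U \<and> U \<noteq> {}}"
    unfolding network_def using openin_subset by blast
  then have "{\<N>. network Y \<N>} \<noteq> {}" by blast
  from aleph0_min_card_attained[OF this, folded network_weight_def]
  obtain \<N> where \<N>: "network Y \<N>" "|\<N>| \<le>o network_weight Y"
    by blast
  define D where "D = (\<lambda>C. SOME y. y \<in> C) ` \<N>"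
  have some: "(SOME y. y \<in> C) \<in> C" if "C \<in> \<N>" for C
    using that \<N>(1) unfolding network_def by (simp add: some_in_eq)
  have "D \<subseteq> topspace Y"
    using some \<N>(1) unfolding D_def network_def by blast
  moreover have "Y closure_of D = topspace Y"
  proof (rule antisym[OF closure_of_subset_topspace], rule subsetI)
    fix y assume y: "y \<in> topspace Y"
    have "\<exists>z. z \<in> D \<and> z \<in> U" if U: "y \<in> U \<and> openin Y U" for U
    proof -
      obtain C where C: "C \<in> \<N>" "C \<subseteq> U" using \<N>(1) U unfolding network_def by meson
      then have "(SOME y. y \<in> C) \<in> D" "(SOME y. y \<in> C) \<in> U"
        using some[of C] unfolding D_def by auto
      then show ?thesis by blast
    qed
    with y show "y \<in> Y closure_of D" unfolding in_closure_of by blast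
  qed
  moreover have "|D| \<le>o network_weight Y"
    unfolding D_def by (rule ordLeq_transitive[OF card_of_image \<N>(2)])
  ultimately show ?thesis
    unfolding topological_density_def
    by (intro aleph0_min_card_least) (auto simp: network_weight_def Cinfinite_natLeq_csum)
qed

section \<open>Narrowness of abelian topological groups\<close>

text \<open>
  In a maximal subset of \<open>A\<close> whose elements are pairwise related, every other element of \<open>A\<close> must
  be unrelated to some member. Applied to disjointness of translates of a neighborhood, it yields
  the translations in \<open>narrowness_index_le_cellularity\<close>.
\<close>

lemma maximal_pairwise_subset:
  "\<exists>S\<subseteq>A. pairwise R S \<and> (\<forall>y\<in>A - S. \<exists>s\<in>S. \<not> R y s \<or> \<not> R s y)"
proof -
  let ?\<A> = "{S. S \<subseteq> A \<and> pairwise R S}"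
  have "\<exists>S\<in>?\<A>. \<forall>T\<in>?\<A>. S \<subseteq> T \<longrightarrow> T = S"
  proof (rule subset_Zorn')
    fix C assume C: "subset.chain ?\<A> C"
    then have "C \<subseteq> ?\<A>" and "chain\<^sub>\<subseteq> C"
      unfolding subset_chain_def chain_subset_def by simp_all
    then have "\<Union>C \<subseteq> A" "pairwise R (\<Union>C)"
      by (blast, intro pairwise_chain_Union) blast+
    then show "\<Union>C \<in> ?\<A>" by simp
  qed
  then obtain S where "S \<in> ?\<A>" and max: "\<forall>T\<in>?\<A>. S \<subseteq> T \<longrightarrow> T = S"
    by (rule bexE)
  then have S: "S \<subseteq> A" "pairwise R S" by simp_all
  have "\<exists>s\<in>S. \<not> R y s \<or> \<not> R s y" if "y \<in> A - S" for y
  proof (rule ccontr)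
    assume "\<not> ?thesis"
    then have "pairwise R (insert y S)"
      using S(2) by (simp add: pairwise_insert)
    with S(1) that have "insert y S \<in> ?\<A>" by simp
    with max have "insert y S = S" by blast
    with that show False by blast
  qed
  with S show ?thesis by (intro exI[of _ S] conjI ballI)
qed

text \<open>
  The group is a subset of the ambient type, as in the definition of narrowness. The topology is
  described through translations and through continuity of subtraction at zero, which together
  amount to joint continuity of subtraction and are the form in which all arguments below use it.
\<close>

locale abelian_topological_group =
  fixes Y :: "'b::ab_group_add topology"
  assumes zero_in: "0 \<in> topspace Y"
    and diff_in: "\<And>x y. x \<in> topspace Y \<Longrightarrow> y \<in> topspace Y \<Longrightarrow> x - y \<in> topspace Y"
    and openin_translation: "\<And>U a. openin Y U \<Longrightarrow> a \<in> topspace Y \<Longrightarrow> openin Y ((+) a ` U)"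
    and diff_continuous_at_zero: "\<And>U. openin Y U \<Longrightarrow> 0 \<in> U \<Longrightarrow>
      \<exists>V. openin Y V \<and> 0 \<in> V \<and> (\<forall>v\<in>V. \<forall>w\<in>V. v - w \<in> U)"
begin

lemma uminus_in: "x \<in> topspace Y \<Longrightarrow> - x \<in> topspace Y"
  using diff_in[OF zero_in, of x] by simp

lemma add_in: "x \<in> topspace Y \<Longrightarrow> y \<in> topspace Y \<Longrightarrow> x + y \<in> topspace Y"
  using diff_in[OF _ uminus_in, of x y] by simp

text \<open>
  Open neighborhoods suffice, and \<open>Y = V + S\<close> is restated as every point being within \<open>V\<close> of \<open>S\<close>.
\<close>

lemma narrow_iff:
  "narrow r Y \<longleftrightarrow> (\<forall>V. openin Y V \<and> 0 \<in> V \<longrightarrow>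
     (\<exists>S\<subseteq>topspace Y. |S| \<le>o r \<and> (\<forall>y\<in>topspace Y. \<exists>s\<in>S. y - s \<in> V)))"
proof
  assume n: "narrow r Y"
  show "\<forall>V. openin Y V \<and> 0 \<in> V \<longrightarrow>
     (\<exists>S\<subseteq>topspace Y. |S| \<le>o r \<and> (\<forall>y\<in>topspace Y. \<exists>s\<in>S. y - s \<in> V))"
  proof (intro allI impI)
    fix V assume V: "openin Y V \<and> 0 \<in> V"
    then have "V \<subseteq> topspace Y \<and> (\<exists>W. openin Y W \<and> 0 \<in> W \<and> W \<subseteq> V)"
      using openin_subset[of Y V] by blast
    with n obtain S where S: "S \<subseteq> topspace Y" "|S| \<le>o r"
        "topspace Y = {u + s | u s. u \<in> V \<and> s \<in> S}"
      unfolding narrow_def by meson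
    have "\<exists>s\<in>S. y - s \<in> V" if "y \<in> topspace Y" for y
    proof -
      have "y \<in> {u + s | u s. u \<in> V \<and> s \<in> S}"
        using that by (rule back_subst) (rule S(3))
      then obtain u s where us: "y = u + s" "u \<in> V" "s \<in> S" by blast
      then have "y - s \<in> V" by simp
      with us(3) show ?thesis by blast
    qed
    with S(1,2) show "\<exists>S\<subseteq>topspace Y. |S| \<le>o r \<and> (\<forall>y\<in>topspace Y. \<exists>s\<in>S. y - s \<in> V)"
      by (intro exI[of _ S] conjI ballI)
  qed
next
  assume R: "\<forall>V. openin Y V \<and> 0 \<in> V \<longrightarrow>
     (\<exists>S\<subseteq>topspace Y. |S| \<le>o r \<and> (\<forall>y\<in>topspace Y. \<exists>s\<in>S. y - s \<in> V))"
  show "narrow r Y"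
    unfolding narrow_def
  proof (intro allI impI, elim conjE exE)
    fix U V assume U: "U \<subseteq> topspace Y" and V: "openin Y V" "0 \<in> V" "V \<subseteq> U"
    from R V(1,2) obtain S
      where S: "S \<subseteq> topspace Y" "|S| \<le>o r" "\<forall>y\<in>topspace Y. \<exists>s\<in>S. y - s \<in> V"
      by meson
    have "topspace Y = {u + s | u s. u \<in> U \<and> s \<in> S}"
    proof (intro set_eqI iffI)
      fix y assume "y \<in> topspace Y"
      with S(3) obtain s where s: "s \<in> S" "y - s \<in> V" by blast
      have "y = (y - s) + s" by simp
      moreover have "y - s \<in> U" using s(2) V(3) by blast
      ultimately show "y \<in> {u + s | u s. u \<in> U \<and> s \<in> S}" using s(1) by blast
    next
      fix y assume "y \<in> {u + s | u s. u \<in> U \<and> s \<in> S}"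
      then obtain u s where "y = u + s" "u \<in> U" "s \<in> S" by blast
      then show "y \<in> topspace Y" using add_in U S(1) by blast
    qed
    with S(1,2) show "\<exists>S. S \<subseteq> topspace Y \<and> |S| \<le>o r \<and> topspace Y = {u + s | u s. u \<in> U \<and> s \<in> S}"
      by (intro exI[of _ S] conjI)
  qed
qed

lemma narrow_mono: "narrow p Y \<Longrightarrow> p \<le>o r \<Longrightarrow> narrow r Y"
  unfolding narrow_iff by (meson ordLeq_transitive)

lemma narrow_UNIV: "narrow |UNIV :: (nat + 'b) set| Y"
  unfolding narrow_iff
proof (intro allI impI)
  fix V assume "openin Y V \<and> 0 \<in> V"
  then have "\<forall>y\<in>topspace Y. \<exists>s\<in>topspace Y. y - s \<in> V" by (metis diff_self)
  moreover have "|topspace Y| \<le>o |UNIV :: (nat + 'b) set|"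
    by (rule card_of_ordLeqI[where f = Inr]) auto
  ultimately show "\<exists>S\<subseteq>topspace Y. |S| \<le>o |UNIV :: (nat + 'b) set| \<and> (\<forall>y\<in>topspace Y. \<exists>s\<in>S. y - s \<in> V)"
    by (intro exI[of _ "topspace Y"] conjI subset_refl)
qed

lemma narrow_narrowness_index: "narrow (narrowness_index Y) Y"
proof -
  have "infinite (UNIV :: (nat + 'b) set)" by simp
  with narrow_UNIV have "{L :: (nat + 'b) set. infinite L \<and> narrow |L| Y} \<noteq> {}" by blast
  from aleph0_min_card_attained[OF this, folded narrowness_index_def]
  obtain L :: "(nat + 'b) set" where "narrow |L| Y" "|L| \<le>o narrowness_index Y"
    by blast
  then show ?thesis by (rule narrow_mono)
qed

text \<open>
  The minimum in \<open>narrowness_index\<close> is over subsets of \<open>nat + 'b\<close>, whereas \<open>r\<close> may live on any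
  type. Either \<open>r\<close> is at least the cardinality of \<open>nat + 'b\<close>, for which \<open>Y\<close> is always narrow, or
  \<open>r\<close> is the cardinality of a subset of it.
\<close>

lemma narrowness_index_least:
  fixes r :: "'c rel"
  assumes r: "Cinfinite r" and n: "narrow r Y"
  shows "narrowness_index Y \<le>o r"
proof -
  have "\<exists>L :: (nat + 'b) set. infinite L \<and> narrow |L| Y \<and> |L| \<le>o r"
  proof (cases "|UNIV :: (nat + 'b) set| \<le>o r")
    case True
    with narrow_UNIV show ?thesis by (intro exI[of _ UNIV]) simp
  next
    case False
    have rF: "r =o |Field r|"
      using r by (simp add: card_of_Field_ordIso ordIso_symmetric)
    have "\<not> |UNIV :: (nat + 'b) set| \<le>o |Field r|"
      using False ordLeq_ordIso_trans[OF _ ordIso_symmetric[OF rF]] by blast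
    then have "|Field r| \<le>o |UNIV :: (nat + 'b) set|"
      using ordLeq_total[OF card_of_Well_order card_of_Well_order] by blast
    then obtain L :: "(nat + 'b) set" where L: "|Field r| =o |L|"
      by (meson internalize_card_of_ordLeq2)
    then have rL: "r =o |L|" by (rule ordIso_transitive[OF rF])
    have "infinite L"
      using card_of_ordIso_finite[OF L] r unfolding cinfinite_def by simp
    moreover have "narrow |L| Y"
      by (rule narrow_mono[OF n ordIso_imp_ordLeq[OF rL]])
    moreover have "|L| \<le>o r"
      by (rule ordIso_imp_ordLeq[OF ordIso_symmetric[OF rL]])
    ultimately show ?thesis by blast
  qed
  then show ?thesis
    unfolding narrowness_index_def by (auto intro: aleph0_min_card_least[OF r])
qed

text \<open>
  Let \<open>V - V \<subseteq> U\<close> and let \<open>S\<close> be maximal such that the translates \<open>s + V\<close> are disjoint; there are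
  at most as many as the cellularity allows. By maximality \<open>y + V\<close> meets some \<open>s + V\<close>, and
  \<open>y + v = s + w\<close> gives \<open>y - s = w - v \<in> U\<close>.
\<close>

lemma narrowness_index_le_cellularity: "narrowness_index Y \<le>o cellularity Y"
proof (rule narrowness_index_least)
  show "Cinfinite (cellularity Y)"
    unfolding cellularity_def by (rule Cinfinite_natLeq_csum)
  show "narrow (cellularity Y) Y"
    unfolding narrow_iff
  proof (intro allI impI)
    fix U assume "openin Y U \<and> 0 \<in> U"
    then obtain V where V: "openin Y V" "0 \<in> V" "\<And>v w. v \<in> V \<Longrightarrow> w \<in> V \<Longrightarrow> v - w \<in> U"
      by (meson diff_continuous_at_zero)
    define R where "R s t = disjnt ((+) s ` V) ((+) t ` V)" for s t
    obtain S where S: "S \<subseteq> topspace Y" "pairwise R S"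
      and max: "\<forall>y\<in>topspace Y - S. \<exists>s\<in>S. \<not> R y s \<or> \<not> R s y"
      using maximal_pairwise_subset[of "topspace Y" R] by (elim exE conjE)
    have "\<exists>s\<in>S. y - s \<in> U" if y: "y \<in> topspace Y" for y
    proof -
      have "\<not> R y y" using V(2) unfolding R_def disjnt_def by blast
      then have "\<exists>s\<in>S. \<not> R y s"
        using max y disjnt_sym unfolding R_def by (cases "y \<in> S") blast+
      then obtain s v w where s: "s \<in> S" "v \<in> V" "w \<in> V" "y + v = s + w"
        unfolding R_def disjnt_def by blast
      then have "y - s = w - v" by (simp add: algebra_simps)
      with V(3)[OF s(3,2)] s(1) show ?thesis by metis
    qed
    moreover have "|S| \<le>o cellularity Y"
    proof -
      have "inj_on (\<lambda>s. (+) s ` V) S"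
      proof (rule inj_onI, rule ccontr)
        fix s t assume "s \<in> S" "t \<in> S" "(+) s ` V = (+) t ` V" "s \<noteq> t"
        then show False
          using S(2) V(2) unfolding pairwise_def R_def disjnt_def by blast
      qed
      then have 1: "|S| \<le>o |(\<lambda>s. (+) s ` V) ` S|"
        by (intro card_of_ordLeqI) auto
      have 2: "|(\<lambda>s. (+) s ` V) ` S| \<le>o
          sup_card {\<U>. (\<forall>U\<in>\<U>. openin Y U) \<and> pairwise disjnt \<U>}" 
      proof (rule sup_card_upper, rule CollectI, rule conjI)
        show "\<forall>W\<in>(\<lambda>s. (+) s ` V) ` S. openin Y W"
          using S(1) V(1) openin_translation by blast
        show "pairwise disjnt ((\<lambda>s. (+) s ` V) ` S)"
          unfolding pairwise_image
          by (rule pairwise_mono[OF S(2)]) (simp_all only: R_def simp_thms subset_refl)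
      qed
      show ?thesis
        unfolding cellularity_def
        by (intro ordLeq_transitive[OF ordLeq_transitive[OF 1 2]] ordLeq_csum2)
          (simp add: sup_card_def Card_order_min_card)
    qed
    ultimately show "\<exists>S\<subseteq>topspace Y. |S| \<le>o cellularity Y \<and> (\<forall>y\<in>topspace Y. \<exists>s\<in>S. y - s \<in> U)"
      using S(1) by (intro exI[of _ S] conjI ballI) auto
  qed
qed

text \<open>
  The translates of \<open>U\<close> by all group elements cover the group; a subcover selects the set \<open>S\<close>.
\<close>

lemma narrowness_index_le_lindelof_degree: "narrowness_index Y \<le>o lindelof_degree Y"
proof (rule narrowness_index_least)
  show "Cinfinite (lindelof_degree Y)"
    unfolding lindelof_degree_def by (rule Cinfinite_natLeq_csum)
  let ?F = "{M :: 'b set set. \<forall>\<U>. (\<forall>U\<in>\<U>. openin Y U) \<and> \<Union>\<U> = topspace Y \<longrightarrow>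
       (\<exists>\<V>. \<V> \<subseteq> \<U> \<and> \<Union>\<V> = topspace Y \<and> |\<V>| \<le>o |M| )}"
  have "UNIV \<in> ?F" by (auto intro: card_of_mono1)
  then have "?F \<noteq> {}" by blast
  from aleph0_min_card_attained[OF this, folded lindelof_degree_def]
  obtain M where M: "M \<in> ?F" "|M| \<le>o lindelof_degree Y"
    by blast
  show "narrow (lindelof_degree Y) Y"
    unfolding narrow_iff
  proof (intro allI impI)
    fix U assume U: "openin Y U \<and> 0 \<in> U"
    let ?t = "\<lambda>s. (+) s ` U"
    have op: "openin Y (?t s)" if "s \<in> topspace Y" for s
      using U that openin_translation by blast
    have "\<Union>(?t ` topspace Y) = topspace Y"
    proof
      show "\<Union>(?t ` topspace Y) \<subseteq> topspace Y"
        using op openin_subset by blast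
      show "topspace Y \<subseteq> \<Union>(?t ` topspace Y)"
        using U by (intro subsetI UN_I image_eqI[of _ _ 0]) simp_all
    qed
    moreover have "\<forall>W\<in>?t ` topspace Y. openin Y W" using op by blast
    ultimately have "\<exists>\<V>\<subseteq>?t ` topspace Y. \<Union>\<V> = topspace Y \<and> |\<V>| \<le>o |M|"
      by (intro M(1)[unfolded mem_Collect_eq, rule_format] conjI)
    then obtain \<V> where \<V>: "\<V> \<subseteq> ?t ` topspace Y" "\<Union>\<V> = topspace Y" "|\<V>| \<le>o |M|"
      by (elim exE conjE)
    \<comment> \<open>Injectivity keeps \<open>S\<close> as small as the subcover.\<close>
    obtain S where S: "S \<subseteq> topspace Y" "\<V> = ?t ` S" "inj_on ?t S"
      using \<V>(1) unfolding subset_image_inj by (elim exE conjE)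
    have "|S| \<le>o |\<V>|"
      using S(3) by (rule card_of_ordLeqI) (simp add: S(2))
    then have "|S| \<le>o lindelof_degree Y"
      by (rule ordLeq_transitive[OF _ ordLeq_transitive[OF \<V>(3) M(2)]])
    moreover have "\<forall>y\<in>topspace Y. \<exists>s\<in>S. y - s \<in> U"
    proof
      fix y assume "y \<in> topspace Y"
      then obtain s u where "s \<in> S" "u \<in> U" "y = s + u" using \<V>(2) S(2) by blast
      then have "s \<in> S" "y - s \<in> U" by simp_all
      then show "\<exists>s\<in>S. y - s \<in> U" by blast
    qed
    ultimately show "\<exists>S\<subseteq>topspace Y. |S| \<le>o lindelof_degree Y \<and> (\<forall>y\<in>topspace Y. \<exists>s\<in>S. y - s \<in> U)"
      using S(1) by (intro exI[of _ S] conjI ballI) auto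
  qed
qed

text \<open>
  Let \<open>V - V \<subseteq> U\<close>. A dense set meets \<open>y + V\<close>, say in \<open>d = y + v\<close>, and then \<open>y - d = 0 - v \<in> U\<close>.
\<close>

lemma narrowness_index_le_density: "narrowness_index Y \<le>o topological_density Y"
proof (rule narrowness_index_least)
  show "Cinfinite (topological_density Y)"
    unfolding topological_density_def by (rule Cinfinite_natLeq_csum)
  have "topspace Y \<in> {D. D \<subseteq> topspace Y \<and> Y closure_of D = topspace Y}"
    by (simp add: closure_of_topspace)
  then have "{D. D \<subseteq> topspace Y \<and> Y closure_of D = topspace Y} \<noteq> {}" by blast
  from aleph0_min_card_attained[OF this, folded topological_density_def]
  obtain D where D: "D \<subseteq> topspace Y" "Y closure_of D = topspace Y" "|D| \<le>o topological_density Y"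
    by blast
  show "narrow (topological_density Y) Y"
    unfolding narrow_iff
  proof (intro allI impI)
    fix U assume "openin Y U \<and> 0 \<in> U"
    then obtain V where V: "openin Y V" "0 \<in> V" "\<And>v w. v \<in> V \<Longrightarrow> w \<in> V \<Longrightarrow> v - w \<in> U"
      by (meson diff_continuous_at_zero)
    have "\<exists>d\<in>D. y - d \<in> U" if y: "y \<in> topspace Y" for y
    proof -
      have "y \<in> (+) y ` V" using V(2) by (metis add_0_right image_eqI)
      moreover have "y \<in> Y closure_of D" using y D(2) by simp
      ultimately obtain d where "d \<in> D" "d \<in> (+) y ` V"
        using openin_translation[OF V(1) y] unfolding in_closure_of by blast
      then obtain v where "d \<in> D" "v \<in> V" "d = y + v" by blast
      moreover from this have "y - d = 0 - v" by simp
      ultimately show ?thesis using V(2,3) by metis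
    qed
    then show "\<exists>S\<subseteq>topspace Y. |S| \<le>o topological_density Y \<and> (\<forall>y\<in>topspace Y. \<exists>s\<in>S. y - s \<in> U)"
      using D(1,3) by (intro exI[of _ D] conjI ballI)
  qed
qed

text \<open>
  Every \<open>V\<close> in a local base \<open>\<N>\<close> at zero comes with a set of at most \<open>r\<close> translates of \<open>V\<close> that
  cover the group, and all these translates together form a base: if \<open>V - V \<subseteq> U - y\<close> and \<open>y\<close> lies
  in the translate \<open>s + V\<close>, then \<open>s + V \<subseteq> U\<close>.
\<close>

lemma weight_le_if_small_local_base:
  assumes r: "Cinfinite r" and n: "narrow r Y"
    and \<N>: "\<And>V. V \<in> \<N> \<Longrightarrow> openin Y V \<and> 0 \<in> V" "|\<N>| \<le>o r"
    and local_base: "\<And>U. openin Y U \<Longrightarrow> 0 \<in> U \<Longrightarrow> \<exists>V\<in>\<N>. V \<subseteq> U"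
  shows "weight Y \<le>o r"
proof -
  have "\<exists>S\<subseteq>topspace Y. |S| \<le>o r \<and> (\<forall>y\<in>topspace Y. \<exists>s\<in>S. y - s \<in> V)" if "V \<in> \<N>" for V
    using n \<N>(1)[OF that] unfolding narrow_iff by meson
  then obtain S where S: "\<And>V. V \<in> \<N> \<Longrightarrow> S V \<subseteq> topspace Y" "\<And>V. V \<in> \<N> \<Longrightarrow> |S V| \<le>o r"
    "\<And>V y. V \<in> \<N> \<Longrightarrow> y \<in> topspace Y \<Longrightarrow> \<exists>s\<in>S V. y - s \<in> V"
    by metis
  define \<C> where "\<C> = (\<lambda>(V, s). (+) s ` V) ` (SIGMA V:\<N>. S V)"
  have "topology_base Y \<C>"
    unfolding topology_base_def
  proof (intro conjI ballI allI impI)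
    fix W assume "W \<in> \<C>"
    then obtain V s where Vs: "V \<in> \<N>" "s \<in> S V" and W: "W = (+) s ` V"
      unfolding \<C>_def by (elim imageE SigmaE) simp
    have "s \<in> topspace Y" using S(1)[OF Vs(1)] Vs(2) by (rule subsetD)
    then show "openin Y W"
      unfolding W using \<N>(1)[OF Vs(1)] by (intro openin_translation) simp_all
  next
    fix U y assume Uy: "openin Y U \<and> y \<in> U"
    then have y: "y \<in> topspace Y" using openin_subset by blast
    have "openin Y ((+) (- y) ` U)" using Uy uminus_in[OF y] by (intro openin_translation) simp_all
    moreover have "0 \<in> (+) (- y) ` U" using Uy by (metis add.left_inverse image_eqI)
    ultimately obtain V0 where V0: "openin Y V0" "0 \<in> V0"
      "\<And>v w. v \<in> V0 \<Longrightarrow> w \<in> V0 \<Longrightarrow> v - w \<in> (+) (- y) ` U"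
      by (meson diff_continuous_at_zero)
    then obtain V where V: "V \<in> \<N>" "V \<subseteq> V0" by (meson local_base)
    obtain s where s: "s \<in> S V" "y - s \<in> V" using S(3)[OF V(1) y] by (rule bexE)
    have "(+) s ` V \<subseteq> U"
    proof
      fix z assume "z \<in> (+) s ` V"
      then obtain v where v: "v \<in> V" "z = s + v" by blast
      then have "v \<in> V0" "y - s \<in> V0" using V(2) s(2) by blast+
      then have "v - (y - s) \<in> (+) (- y) ` U" by (rule V0(3))
      then obtain u where u: "u \<in> U" "v - (y - s) = - y + u" by blast
      have "u = z" using u(2) v(2) by (simp add: algebra_simps)
      with u show "z \<in> U" by simp
    qed
    moreover have "y \<in> (+) s ` V" using s(2) by (intro image_eqI[of _ _ "y - s"]) simp_all
    moreover have "(+) s ` V \<in> \<C>"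
      unfolding \<C>_def using V(1) s(1) by (intro image_eqI[of _ _ "(V, s)"] SigmaI) simp_all
    ultimately show "\<exists>W\<in>\<C>. y \<in> W \<and> W \<subseteq> U" by blast
  qed
  moreover have "|\<C>| \<le>o r"
  proof -
    have "|SIGMA V:\<N>. S V| \<le>o r"
      using r \<N>(2) S(2) by (intro card_of_Sigma_ordLeq_infinite_Field ballI) (simp_all add: cinfinite_def)
    then show ?thesis unfolding \<C>_def by (rule ordLeq_transitive[OF card_of_image])
  qed
  ultimately show ?thesis
    unfolding weight_def by (intro aleph0_min_card_least[OF r, of \<C>]) simp_all
qed

end

section \<open>The Whitney topology\<close>

definition whitney_ball :: "'a::topological_space set \<Rightarrow> ('a \<Rightarrow> real) \<Rightarrow> ('a \<Rightarrow> real) set" where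
  "whitney_ball B \<epsilon> = whitney_entourage B \<epsilon> `` {0}"

lemma mem_whitney_ball: "g \<in> whitney_ball B \<epsilon> \<longleftrightarrow> g \<in> cont_funs \<and> (\<forall>x\<in>B. \<bar>g x\<bar> < \<epsilon> x)"
  by (auto simp: whitney_ball_def whitney_entourage_def cont_funs_def zero_fun_def)

lemma whitney_ball_mono:
  assumes "B \<subseteq> C" "\<And>x. x \<in> B \<Longrightarrow> \<delta> x \<le> \<epsilon> x"
  shows "whitney_ball C \<delta> \<subseteq> whitney_ball B \<epsilon>"
  using assms by (force simp: mem_whitney_ball subset_iff)

lemma zero_in_whitney_ball: "\<epsilon> \<in> pos_cont_funs \<Longrightarrow> 0 \<in> whitney_ball B \<epsilon>"
  by (simp add: mem_whitney_ball pos_cont_funs_def cont_funs_def zero_fun_def)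

lemma cont_funs_diff: "f \<in> cont_funs \<Longrightarrow> g \<in> cont_funs \<Longrightarrow> f - g \<in> cont_funs"
  by (simp add: cont_funs_def fun_diff_def continuous_on_diff)

lemma cont_funs_add: "f \<in> cont_funs \<Longrightarrow> g \<in> cont_funs \<Longrightarrow> f + g \<in> cont_funs"
  by (simp add: cont_funs_def plus_fun_def continuous_on_add)

lemma mem_whitney_section:
  assumes "f \<in> cont_funs"
  shows "g \<in> whitney_entourage B \<epsilon> `` {f} \<longleftrightarrow> g \<in> cont_funs \<and> (\<forall>x\<in>B. \<bar>g x - f x\<bar> < \<epsilon> x)"
  using assms by (auto simp: whitney_entourage_def abs_minus_commute)

lemma closed_superset_in_bornology:
  assumes "has_closed_base \<B>" "B \<in> \<B>"
  obtains C where "C \<in> \<B>" "closed C" "B \<subseteq> C"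
  using assms unfolding has_closed_base_def bornology_base_def by blast

text \<open>
  For \<open>f\<close> in the ball, \<open>\<epsilon> - \<bar>f\<bar>\<close> is a suitable radius on \<open>B\<close> but may fail to be positive
  elsewhere. Adding the distance to \<open>B\<close> to its positive part repairs this and changes nothing on
  \<open>B\<close>; closedness of \<open>B\<close> makes that distance positive off \<open>B\<close>.
\<close>

lemma openin_whitney_ball:
  fixes B :: "'a::metric_space set"
  assumes "bornology \<B>" and B: "B \<in> \<B>" "closed B" and \<epsilon>: "\<epsilon> \<in> pos_cont_funs"
  shows "openin (whitney_topology \<B>) (whitney_ball B \<epsilon>)"
  unfolding openin_whitney_topology[OF assms(1)]
proof (intro conjI ballI)
  show "whitney_ball B \<epsilon> \<subseteq> cont_funs" by (auto simp: mem_whitney_ball)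
  fix f assume f: "f \<in> whitney_ball B \<epsilon>"
  define \<delta> where "\<delta> x = max 0 (\<epsilon> x - \<bar>f x\<bar>) + infdist x B" for x
  have "B \<noteq> {}" using assms unfolding bornology_def by blast
  then have pos: "0 < infdist x B" if "x \<notin> B" for x
    using infdist_pos_not_in_closed[OF B(2)] that by blast
  have "0 < \<delta> x" for x
  proof (cases "x \<in> B")
    case True
    then have "\<bar>f x\<bar> < \<epsilon> x" using f by (simp add: mem_whitney_ball)
    then show ?thesis unfolding \<delta>_def using infdist_nonneg[of x B] by linarith
  next
    case False
    then show ?thesis unfolding \<delta>_def using pos[OF False] by linarith
  qed
  moreover have "continuous_on UNIV \<delta>"
    unfolding \<delta>_def using f \<epsilon>
    by (auto simp: mem_whitney_ball cont_funs_def pos_cont_funs_def intro!: continuous_intros)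
  ultimately have "\<delta> \<in> pos_cont_funs" by (simp add: pos_cont_funs_def)
  moreover have "whitney_entourage B \<delta> `` {f} \<subseteq> whitney_ball B \<epsilon>"
  proof
    fix g assume "g \<in> whitney_entourage B \<delta> `` {f}"
    then have g: "g \<in> cont_funs" "\<forall>x\<in>B. \<bar>g x - f x\<bar> < \<delta> x"
      using f mem_whitney_section[of f g B \<delta>] by (simp_all add: mem_whitney_ball)
    have "\<bar>g x\<bar> < \<epsilon> x" if "x \<in> B" for x
    proof -
      have "\<bar>f x\<bar> < \<epsilon> x" using f that by (simp add: mem_whitney_ball)
      then have "\<delta> x = \<epsilon> x - \<bar>f x\<bar>" unfolding \<delta>_def using that by simp
      then show ?thesis using g(2) that by force
    qed
    with g(1) show "g \<in> whitney_ball B \<epsilon>" by (simp add: mem_whitney_ball)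
  qed
  ultimately show "\<exists>B'\<in>\<B>. \<exists>\<delta>\<in>pos_cont_funs. whitney_entourage B' \<delta> `` {f} \<subseteq> whitney_ball B \<epsilon>"
    using B(1) by blast
qed

lemma whitney_abelian_topological_group:
  fixes \<B> :: "'a::metric_space set set"
  assumes b: "bornology \<B>" and cb: "has_closed_base \<B>"
  shows "abelian_topological_group (whitney_topology \<B>)"
proof
  note top = topspace_whitney_topology[OF b]
  show "0 \<in> topspace (whitney_topology \<B>)"
    unfolding top by (simp add: cont_funs_def zero_fun_def)
  show "f - g \<in> topspace (whitney_topology \<B>)"
    if "f \<in> topspace (whitney_topology \<B>)" "g \<in> topspace (whitney_topology \<B>)" for f g
    using that unfolding top by (rule cont_funs_diff)
  show "openin (whitney_topology \<B>) ((+) a ` U)"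
    if U: "openin (whitney_topology \<B>) U" and "a \<in> topspace (whitney_topology \<B>)" for U a
    unfolding openin_whitney_topology[OF b]
  proof (intro conjI ballI)
    have a: "a \<in> cont_funs" using that(2) unfolding top .
    have Uc: "U \<subseteq> cont_funs" using U unfolding openin_whitney_topology[OF b] by blast
    show "(+) a ` U \<subseteq> cont_funs" using a Uc cont_funs_add by blast
    fix h assume "h \<in> (+) a ` U"
    then obtain f where f: "f \<in> U" "h = a + f" by blast
    then obtain B \<epsilon> where B: "B \<in> \<B>" "\<epsilon> \<in> pos_cont_funs" "whitney_entourage B \<epsilon> `` {f} \<subseteq> U"
      using U unfolding openin_whitney_topology[OF b] by blast
    have "whitney_entourage B \<epsilon> `` {h} \<subseteq> (+) a ` U"
    proof
      fix g assume "g \<in> whitney_entourage B \<epsilon> `` {h}"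
      then have g: "g \<in> cont_funs" "\<forall>x\<in>B. \<bar>g x - h x\<bar> < \<epsilon> x"
        using cont_funs_add[OF a] f Uc mem_whitney_section[of h g B \<epsilon>] by auto
      have "g - a \<in> whitney_entourage B \<epsilon> `` {f}"
        using f Uc g(2) cont_funs_diff[OF g(1) a] mem_whitney_section[of f "g - a" B \<epsilon>]
        by (auto simp: algebra_simps)
      with B(3) have "g - a \<in> U" by blast
      moreover have "g = a + (g - a)" by simp
      ultimately show "g \<in> (+) a ` U" by blast
    qed
    with B show "\<exists>B\<in>\<B>. \<exists>\<epsilon>\<in>pos_cont_funs. whitney_entourage B \<epsilon> `` {h} \<subseteq> (+) a ` U" by blast
  qed
  show "\<exists>V. openin (whitney_topology \<B>) V \<and> 0 \<in> V \<and> (\<forall>v\<in>V. \<forall>w\<in>V. v - w \<in> U)"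
    if U: "openin (whitney_topology \<B>) U" "0 \<in> U" for U
  proof -
    obtain B \<epsilon> where B: "B \<in> \<B>" "\<epsilon> \<in> pos_cont_funs" "whitney_ball B \<epsilon> \<subseteq> U"
      using U unfolding openin_whitney_topology[OF b] whitney_ball_def by blast
    obtain C where C: "C \<in> \<B>" "closed C" "B \<subseteq> C"
      by (rule closed_superset_in_bornology[OF cb B(1)])
    have half: "(\<lambda>x. \<epsilon> x / 2) \<in> pos_cont_funs"
      using B(2) by (auto simp: pos_cont_funs_def intro!: continuous_intros)
    have "v - w \<in> U" if v: "v \<in> whitney_ball C (\<lambda>x. \<epsilon> x / 2)" and w: "w \<in> whitney_ball C (\<lambda>x. \<epsilon> x / 2)" for v w
    proof -
      have "\<bar>v x - w x\<bar> < \<epsilon> x" if "x \<in> B" for x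
      proof -
        have "\<bar>v x\<bar> < \<epsilon> x / 2" "\<bar>w x\<bar> < \<epsilon> x / 2" using v w that C(3) by (auto simp: mem_whitney_ball)
        then show ?thesis by linarith
      qed
      then have "v - w \<in> whitney_ball B \<epsilon>"
        using v w cont_funs_diff[of v w] by (simp add: mem_whitney_ball)
      with B(3) show ?thesis by blast
    qed
    then show ?thesis
      using openin_whitney_ball[OF b C(1,2) half] zero_in_whitney_ball[OF half] by blast
  qed
qed

text \<open>
  Enlarging each member of a smallest base to a closed member of the bornology does not increase
  its size.
\<close>

lemma closed_base_attains_bornology_weight:
  assumes "has_closed_base \<B>"
  obtains \<B>1 where "bornology_base \<B> \<B>1" "\<forall>B\<in>\<B>1. closed B" "|\<B>1| \<le>o bornology_weight \<B>"
proof -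
  have "bornology_base \<B> \<B>" unfolding bornology_base_def by blast
  then have "{\<B>0. bornology_base \<B> \<B>0} \<noteq> {}" by blast
  from aleph0_min_card_attained[OF this, folded bornology_weight_def]
  obtain \<B>0 where \<B>0: "bornology_base \<B> \<B>0" "|\<B>0| \<le>o bornology_weight \<B>"
    by blast
  have "\<exists>C. C \<in> \<B> \<and> closed C \<and> B \<subseteq> C" if B: "B \<in> \<B>0" for B
  proof -
    have "B \<in> \<B>" using \<B>0(1) B unfolding bornology_base_def by blast
    then show ?thesis using closed_superset_in_bornology[OF assms] by metis
  qed
  then obtain f where f: "\<And>B. B \<in> \<B>0 \<Longrightarrow> f B \<in> \<B> \<and> closed (f B) \<and> B \<subseteq> f B" by metis
  show thesis
  proof (rule that)
    show "bornology_base \<B> (f ` \<B>0)"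
      unfolding bornology_base_def
    proof (intro conjI ballI)
      show "f ` \<B>0 \<subseteq> \<B>" using f by blast
      fix B assume "B \<in> \<B>"
      then obtain B0 where B0: "B0 \<in> \<B>0" "B \<subseteq> B0"
        using \<B>0(1) unfolding bornology_base_def by meson
      with f[OF B0(1)] show "\<exists>B'\<in>f ` \<B>0. B \<subseteq> B'" by blast
    qed
    show "\<forall>B\<in>f ` \<B>0. closed B" using f by blast
    show "|f ` \<B>0| \<le>o bornology_weight \<B>" by (rule ordLeq_transitive[OF card_of_image \<B>0(2)])
  qed
qed

text \<open>
  Each member \<open>V\<close> of a base of the topology that contains zero also contains a ball over some
  closed \<open>f V\<close>. The sets \<open>f V\<close> form a base of the bornology: for closed \<open>C\<close>, some \<open>V\<close> lies in the
  unit ball over \<open>C\<close>, and then \<open>C \<subseteq> f V\<close>, since otherwise a continuous function would vanish on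
  \<open>f V\<close>, hence belong to \<open>V\<close>, and yet equal 1 at a point of \<open>C\<close>.
\<close>

lemma bornology_weight_le_weight:
  fixes \<B> :: "'a::metric_space set set"
  assumes b: "bornology \<B>" and cb: "has_closed_base \<B>"
  shows "bornology_weight \<B> \<le>o weight (whitney_topology \<B>)"
proof -
  let ?Y = "whitney_topology \<B>"
  obtain \<C> where \<C>: "topology_base ?Y \<C>" "|\<C>| \<le>o weight ?Y"
    by (rule weight_attained)
  define \<C>0 where "\<C>0 = {V \<in> \<C>. 0 \<in> V}"
  have "\<exists>B. B \<in> \<B> \<and> closed B \<and> (\<exists>\<epsilon>\<in>pos_cont_funs. whitney_ball B \<epsilon> \<subseteq> V)" if "V \<in> \<C>0" for V
  proof -
    have "openin ?Y V" "0 \<in> V" using that \<C>(1) unfolding \<C>0_def topology_base_def by auto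
    then obtain B \<epsilon> where B: "B \<in> \<B>" "\<epsilon> \<in> pos_cont_funs" "whitney_ball B \<epsilon> \<subseteq> V"
      unfolding openin_whitney_topology[OF b] whitney_ball_def by blast
    obtain C where C: "C \<in> \<B>" "closed C" "B \<subseteq> C"
      by (rule closed_superset_in_bornology[OF cb B(1)])
    have "whitney_ball C \<epsilon> \<subseteq> V" using whitney_ball_mono[OF C(3), of \<epsilon> \<epsilon>] B(3) by simp
    with B C show ?thesis by blast
  qed
  then obtain f where f: "\<And>V. V \<in> \<C>0 \<Longrightarrow>
      f V \<in> \<B> \<and> closed (f V) \<and> (\<exists>\<epsilon>\<in>pos_cont_funs. whitney_ball (f V) \<epsilon> \<subseteq> V)"
    by metis
  have "bornology_base \<B> (f ` \<C>0)"
    unfolding bornology_base_def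
  proof (intro conjI ballI)
    show "f ` \<C>0 \<subseteq> \<B>" using f by blast
    fix B assume "B \<in> \<B>"
    then obtain C where C: "C \<in> \<B>" "closed C" "B \<subseteq> C"
      by (rule closed_superset_in_bornology[OF cb])
    have one: "(\<lambda>_. 1) \<in> pos_cont_funs" by (simp add: pos_cont_funs_def)
    obtain V where V: "V \<in> \<C>0" "V \<subseteq> whitney_ball C (\<lambda>_. 1)"
      using \<C>(1) openin_whitney_ball[OF b C(1,2) one] zero_in_whitney_ball[OF one]
      unfolding topology_base_def \<C>0_def by blast
    obtain \<epsilon> where \<epsilon>: "\<epsilon> \<in> pos_cont_funs" "whitney_ball (f V) \<epsilon> \<subseteq> V" using f[OF V(1)] by blast
    have "f V \<in> \<B>" and cl: "closed (f V)" using f[OF V(1)] by simp_all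
    then have ne: "f V \<noteq> {}" using b unfolding bornology_def by auto
    have "C \<subseteq> f V"
    proof (rule ccontr)
      assume "\<not> C \<subseteq> f V"
      then obtain x where x: "x \<in> C" "x \<notin> f V" by blast
      define g where "g y = infdist y (f V) / infdist x (f V)" for y
      have d: "infdist x (f V) > 0" using infdist_pos_not_in_closed[OF cl ne x(2)] .
      have "continuous_on UNIV g"
        unfolding g_def using d by (intro continuous_intros) auto
      moreover have "\<forall>y\<in>f V. \<bar>g y\<bar> < \<epsilon> y" using \<epsilon>(1) by (simp add: g_def pos_cont_funs_def)
      ultimately have "g \<in> whitney_ball (f V) \<epsilon>" by (simp add: mem_whitney_ball cont_funs_def)
      then have "g \<in> whitney_ball C (\<lambda>_. 1)" using \<epsilon>(2) V(2) by blast
      then have "\<bar>g x\<bar> < 1" using x(1) by (simp add: mem_whitney_ball)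
      then show False using d by (simp add: g_def)
    qed
    with V(1) C(3) show "\<exists>B'\<in>f ` \<C>0. B \<subseteq> B'" by blast
  qed
  moreover have "|f ` \<C>0| \<le>o weight ?Y"
  proof -
    have "|\<C>0| \<le>o |\<C>|" by (rule card_of_mono1) (simp add: \<C>0_def)
    from ordLeq_transitive[OF card_of_image this] show ?thesis
      using \<C>(2) by (rule ordLeq_transitive)
  qed
  ultimately show ?thesis
    unfolding bornology_weight_def
    by (intro aleph0_min_card_least[of _ "f ` \<C>0"]) (simp_all add: weight_def Cinfinite_natLeq_csum)
qed

text \<open>
  Narrowness is used twice: to pass from a local base to a base, and, before that, to find few
  radii such that every \<open>\<epsilon>\<close> has one below it. The translations that cover the group by unit balls
  over a closed \<open>B\<close> are, up to an error of 1 on \<open>B\<close>, all continuous functions, hence dominate all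
  reciprocals \<open>1 / \<epsilon>\<close> on \<open>B\<close>.
\<close>

lemma weight_le_bornology_weight_narrowness_index:
  fixes \<B> :: "'a::metric_space set set"
  assumes b: "bornology \<B>" and cb: "has_closed_base \<B>"
  shows "weight (whitney_topology \<B>) \<le>o
    bornology_weight \<B> *c narrowness_index (whitney_topology \<B>)"
proof -
  let ?Y = "whitney_topology \<B>"
  let ?r = "bornology_weight \<B> *c narrowness_index ?Y"
  interpret abelian_topological_group ?Y
    by (rule whitney_abelian_topological_group[OF b cb])
  have ik: "Cinfinite (bornology_weight \<B>)" and ii: "Cinfinite (narrowness_index ?Y)"
    unfolding bornology_weight_def narrowness_index_def by (rule Cinfinite_natLeq_csum)+
  have r: "Cinfinite ?r" by (rule Cinfinite_cprod2[OF Cinfinite_Cnotzero[OF ik] ii])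
  have kr: "bornology_weight \<B> \<le>o ?r"
    by (rule ordLeq_ordIso_trans[OF ordLeq_cprod2[OF Cinfinite_Cnotzero[OF ii] conjunct2[OF ik]] cprod_com])
  have ir: "narrowness_index ?Y \<le>o ?r"
    by (rule ordLeq_cprod2[OF Cinfinite_Cnotzero[OF ik] conjunct2[OF ii]])
  have n: "narrow ?r ?Y" by (rule narrow_mono[OF narrow_narrowness_index ir])
  obtain \<B>1 where \<B>1: "bornology_base \<B> \<B>1" "\<forall>B\<in>\<B>1. closed B" "|\<B>1| \<le>o bornology_weight \<B>"
    by (rule closed_base_attains_bornology_weight[OF cb])
  have one: "(\<lambda>_. 1) \<in> pos_cont_funs" by (simp add: pos_cont_funs_def)
  have \<B>1\<B>: "B \<in> \<B>" if "B \<in> \<B>1" for B using \<B>1(1) that unfolding bornology_base_def by blast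
  have "\<exists>S\<subseteq>cont_funs. |S| \<le>o ?r \<and> (\<forall>f\<in>cont_funs. \<exists>s\<in>S. f - s \<in> whitney_ball B (\<lambda>_. 1))"
    if "B \<in> \<B>1" for B
    by (rule n[unfolded narrow_iff topspace_whitney_topology[OF b], THEN spec, THEN mp, OF conjI,
          OF openin_whitney_ball[OF b \<B>1\<B>[OF that] bspec[OF \<B>1(2) that] one]
             zero_in_whitney_ball[OF one]])
  then obtain S where S: "\<And>B. B \<in> \<B>1 \<Longrightarrow> S B \<subseteq> cont_funs" "\<And>B. B \<in> \<B>1 \<Longrightarrow> |S B| \<le>o ?r"
    "\<And>B f. B \<in> \<B>1 \<Longrightarrow> f \<in> cont_funs \<Longrightarrow> \<exists>s\<in>S B. f - s \<in> whitney_ball B (\<lambda>_. 1)"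
    by metis
  define \<rho> :: "('a \<Rightarrow> real) \<Rightarrow> 'a \<Rightarrow> real" where "\<rho> s x = 1 / (1 + \<bar>s x\<bar>)" for s x
  have \<rho>: "\<rho> s \<in> pos_cont_funs" if "s \<in> cont_funs" for s
  proof -
    have pos: "0 < 1 + \<bar>s x\<bar>" for x by linarith
    then have "continuous_on UNIV (\<lambda>x. 1 / (1 + \<bar>s x\<bar>))"
      using that unfolding cont_funs_def
      by (intro continuous_intros ballI) (simp_all add: less_imp_neq[symmetric])
    with pos show ?thesis by (simp add: \<rho>_def[abs_def] pos_cont_funs_def)
  qed
  define \<N> where "\<N> = (\<lambda>(B, s). whitney_ball B (\<rho> s)) ` (SIGMA B:\<B>1. S B)"
  show ?thesis
  proof (rule weight_le_if_small_local_base[OF r n])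
    fix V assume "V \<in> \<N>"
    then obtain B s where B: "B \<in> \<B>1" "s \<in> S B" "V = whitney_ball B (\<rho> s)" unfolding \<N>_def by auto
    then have "\<rho> s \<in> pos_cont_funs" using S(1)[OF B(1)] by (intro \<rho>) (rule subsetD)
    then show "openin ?Y V \<and> 0 \<in> V"
      unfolding B(3)
      using openin_whitney_ball[OF b \<B>1\<B>[OF B(1)] bspec[OF \<B>1(2) B(1)]] zero_in_whitney_ball by (intro conjI)
  next
    have "|SIGMA B:\<B>1. S B| \<le>o ?r"
      using r S(2) ordLeq_transitive[OF \<B>1(3) kr]
      by (intro card_of_Sigma_ordLeq_infinite_Field ballI) (simp_all add: cinfinite_def)
    then show "|\<N>| \<le>o ?r" unfolding \<N>_def by (rule ordLeq_transitive[OF card_of_image])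
  next
    fix U assume U: "openin ?Y U" "0 \<in> U"
    then obtain B \<epsilon> where B: "B \<in> \<B>" "\<epsilon> \<in> pos_cont_funs" "whitney_ball B \<epsilon> \<subseteq> U"
      unfolding openin_whitney_topology[OF b] whitney_ball_def by blast
    obtain C where C: "C \<in> \<B>1" "B \<subseteq> C" using \<B>1(1) B(1) unfolding bornology_base_def by blast
    have pos: "0 < \<epsilon> x" for x using B(2) by (simp add: pos_cont_funs_def)
    have "(\<lambda>x. 1 / \<epsilon> x) \<in> cont_funs"
      using B(2) pos unfolding cont_funs_def pos_cont_funs_def mem_Collect_eq
      by (intro continuous_intros ballI) (simp_all add: less_imp_neq[symmetric])
    then obtain s where s: "s \<in> S C" "(\<lambda>x. 1 / \<epsilon> x) - s \<in> whitney_ball C (\<lambda>_. 1)"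
      using S(3)[OF C(1)] by blast
    have le: "\<rho> s x < \<epsilon> x" if "x \<in> C" for x
    proof -
      have "\<bar>1 / \<epsilon> x - s x\<bar> < 1" using s(2) that by (simp add: mem_whitney_ball)
      then have "1 / \<epsilon> x < 1 + \<bar>s x\<bar>" by linarith
      then show ?thesis using pos[of x] by (simp add: \<rho>_def field_simps)
    qed
    have "whitney_ball C (\<rho> s) \<subseteq> whitney_ball B \<epsilon>"
      using C(2) le by (intro whitney_ball_mono) (auto intro: less_imp_le)
    moreover have "whitney_ball C (\<rho> s) \<in> \<N>"
      unfolding \<N>_def using C(1) s(1) by (intro image_eqI[of _ _ "(C, s)"] SigmaI) simp_all
    ultimately show "\<exists>V\<in>\<N>. V \<subseteq> U" using B(3) by blast
  qed
qed

theorem theorem4p16: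
  fixes \<B> :: "'a::metric_space set set"
  assumes "\<exists>x y :: 'a. x \<noteq> y"
    and "bornology \<B>"
    and "has_closed_base \<B>"
  shows
    "weight (whitney_topology \<B>) =o bornology_weight \<B> *c narrowness_index (whitney_topology \<B>) \<and>
     bornology_weight \<B> *c narrowness_index (whitney_topology \<B>) =o
       bornology_weight \<B> *c cellularity (whitney_topology \<B>) \<and>
     bornology_weight \<B> *c cellularity (whitney_topology \<B>) =o
       bornology_weight \<B> *c lindelof_degree (whitney_topology \<B>) \<and>
     bornology_weight \<B> *c lindelof_degree (whitney_topology \<B>) =o
       bornology_weight \<B> *c topological_density (whitney_topology \<B>) \<and>
     bornology_weight \<B> *c topological_density (whitney_topology \<B>) =o
       bornology_weight \<B> *c network_weight (whitney_topology \<B>)"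
proof -
  let ?Y = "whitney_topology \<B>"
  interpret abelian_topological_group ?Y
    by (rule whitney_abelian_topological_group[OF assms(2,3)])
  note inf = Cinfinite_natLeq_csum
  note sandwich = cprod_sandwich[OF _ _ _ _ bornology_weight_le_weight[OF assms(2,3)] _ _
      weight_le_bornology_weight_narrowness_index[OF assms(2,3)]]
  have dw: "topological_density ?Y \<le>o weight ?Y"
    by (rule ordLeq_transitive[OF topological_density_le_network_weight network_weight_le_weight])
  have W: "Cinfinite (weight ?Y)" and K: "Card_order (bornology_weight \<B>)"
    and I: "Card_order (narrowness_index ?Y)"
    using inf unfolding weight_def bornology_weight_def narrowness_index_def by blast+
  have i: "weight ?Y =o bornology_weight \<B> *c narrowness_index ?Y"
    by (rule sandwich[OF W K I I ordLeq_transitive[OF narrowness_index_le_density dw]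
          ordLeq_refl[OF I]])
  have c: "weight ?Y =o bornology_weight \<B> *c cellularity ?Y"
    by (rule sandwich[OF W K _ I cellularity_le_weight narrowness_index_le_cellularity])
       (simp add: cellularity_def Card_order_csum)
  have l: "weight ?Y =o bornology_weight \<B> *c lindelof_degree ?Y"
    by (rule sandwich[OF W K _ I lindelof_degree_le_weight narrowness_index_le_lindelof_degree])
       (simp add: lindelof_degree_def Card_order_csum)
  have d: "weight ?Y =o bornology_weight \<B> *c topological_density ?Y"
    by (rule sandwich[OF W K _ I dw narrowness_index_le_density])
       (simp add: topological_density_def Card_order_csum)
  have n: "weight ?Y =o bornology_weight \<B> *c network_weight ?Y"
    by (rule sandwich[OF W K _ I network_weight_le_weight
          ordLeq_transitive[OF narrowness_index_le_density topological_density_le_network_weight]])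
       (simp add: network_weight_def Card_order_csum)
  note eq = ordIso_transitive[OF ordIso_symmetric]
  show ?thesis
    by (intro conjI i eq[OF i c] eq[OF c l] eq[OF l d] eq[OF d n])
qed

end
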